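(* (a) The map $\mathrm{NU}:D\to C$ is a well-defined bijection with inverse $\mathrm{ND}:C\to D$. (b) For $\gamma\in D$, $\mathrm{defc}(\mathrm{NU}(\gamma))=\mathrm{defc}(\gamma)$ and $\mathrm{dinv}(\mathrm{NU}(\gamma))=\mathrm{dinv}(\gamma)+1$. (c) For $\gamma\in C$, $\mathrm{defc}(\mathrm{ND}(\gamma))=\mathrm{defc}(\gamma)$ and $\mathrm{dinv}(\mathrm{ND}(\gamma))=\mathrm{dinv}(\gamma)-1$. (d) For $\gamma\in D$, the (finite or infinite) sequence $\gamma,\mathrm{NU}(\gamma),\mathrm{NU}^2(\gamma),\mathrm{NU}^3(\gamma),\ldots$ (continued as long as $\mathrm{NU}$ is defined) contains no repeated entries.
   Context: A quasi-Dyck vector (QDV) is an integer sequence $v=v_1v_2\cdots v_n$ with $v_1=0$ and $v_{i+1}\le v_i+1$ for all $i<n$. We use word notation; $i^c$ means $c$ copies of the symbol $i$; $W^{+}$ adds $1$ to each entry of $W$. Dyck classes $[v]$ are the equivalence classes of the equivalence relation on QDVs generated by $v\sim 0v^+$. An integer partition $\lambda$ (with $\ell(\lambda)$ positive parts and $\lambda_i=0$ for $i>\ell(\lambda)$; the zero partition $\langle 0\rangle=[0]$ is allowed) is identified with the Dyck class consisting of all QDVs $\mathrm{QDV}_n(\lambda)=(0-\lambda_n,1-\lambda_{n-1},\ldots,n-1-\lambda_1)$, $n>\ell(\lambda)$; this is a bijection between partitions and Dyck classes. For a QDV $v$ of length $n$: $\mathrm{area}(v)=v_1+\cdots+v_n$;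 $\mathrm{dinv}(v)$ is the number of pairs of integers $i<j\le n$ with $v_i-v_j\in\{0,1\}$, where $v_k=k-1$ for all $k\le 0$; $\mathrm{defc}(v)=\binom{n}{2}-\mathrm{area}(v)-\mathrm{dinv}(v)$. Both dinv and defc are constant on Dyck classes, hence defined for partitions. First map. $D_1=\{\gamma:\gamma_1\le\ell(\gamma)+2\}$, $C_1=\{\gamma\ne\langle 0\rangle:\gamma_1\ge\ell(\gamma)\}$. For $\gamma\in D_1$ with $\ell=\ell(\gamma)$, $\mathrm{NU}_1(\gamma)=\langle\ell+1,\gamma_1-1,\ldots,\gamma_\ell-1\rangle$ (zero parts dropped). For $\gamma\in C_1$, $\mathrm{ND}_1(\gamma)=\langle\gamma_2+1,\ldots,\gamma_\ell+1,1^{\gamma_1-\ell}\rangle$. $\mathrm{NU}_1:D_1\to C_1$ is a bijection with inverse $\mathrm{ND}_1$. Second map. Rule (a): for $h\ge 2$ and $A=A_1\cdots A_s$ a list of integers that is empty or satisfies all $A_i\le 2$, $A_s\ge 0$, and $A_{i+1}\le A_i+1$ for $i<s$, set $\mathrm{NU}_2([012^hA(-1)^{h-1}])=[00^{h-1}1A1^h]$. Rule (b): for $k\ge 1$ and $B=B_1\cdots B_s$ a list of integers that is empty or satisfies all $B_i\le 2$, $B_1\le 1$, $B_s\ge -1$, and $B_{i+1}\le B_i+1$ for $i<s$, set $\mathrm{NU}_2([012^kB(-1)^k])=[00^kB01^k]$. $D_2$ (resp. $C_2$) is the set of Dyck classes matching one of the input (resp. output) templates of these two rules; $\mathrm{ND}_2:C_2\to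 D_2$ is obtained by reversing the two rules. Extended maps. $D=D_1\cup D_2$ and $C=C_1\cup C_2$. $\mathrm{NU}(\gamma)=\mathrm{NU}_1(\gamma)$ for $\gamma\in D_1$ and $\mathrm{NU}(\gamma)=\mathrm{NU}_2(\gamma)$ for $\gamma\in D_2$; $\mathrm{ND}(\gamma)=\mathrm{ND}_1(\gamma)$ for $\gamma\in C_1$ and $\mathrm{ND}(\gamma)=\mathrm{ND}_2(\gamma)$ for $\gamma\in C_2$. *)

theory Defs
  imports Complex_Main
begin

section \<open>Quasi-Dyck vectors and Dyck classes\<close>

text \<open>Vectors are lists, so the entry \<open>v\<^sub>i\<close> (with \<open>i \<ge> 1\<close>) is \<open>v ! (i - 1)\<close>.\<close>

definition slow_growth :: "int list \<Rightarrow> bool" where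
  "slow_growth v \<longleftrightarrow> successively (\<lambda>x y. y \<le> x + 1) v"

definition QDV :: "int list set" where
  "QDV = {v. v \<noteq> [] \<and> hd v = 0 \<and> slow_growth v}"

definition plus1 :: "int list \<Rightarrow> int list" where
  "plus1 w = map (\<lambda>x. x + 1) w"

definition dyck_equiv :: "int list \<Rightarrow> int list \<Rightarrow> bool" where
  "dyck_equiv = equivclp (\<lambda>v w. v \<in> QDV \<and> w = 0 # plus1 v)"

definition dyck_class :: "int list \<Rightarrow> int list set" where
  "dyck_class v = {w \<in> QDV. dyck_equiv v w}"

definition area :: "int list \<Rightarrow> int" where
  "area v = sum_list v"

text \<open>The extension of \<open>v\<close> to non-positive indices by \<open>v\<^sub>k = k - 1\<close>.\<close>

definition ext :: "int list \<Rightarrow> int \<Rightarrow> int" where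
  "ext v k = (if k \<le> 0 then k - 1 else v ! nat (k - 1))"

text \<open>The set of pairs is always finite: a pair with \<open>i < j \<le> 0\<close> has negative
  difference, and for fixed \<open>j \<ge> 1\<close> only finitely many \<open>i \<le> 0\<close> contribute.\<close>

definition dinv :: "int list \<Rightarrow> int" where
  "dinv v = int (card {(i, j). i < j \<and> j \<le> int (length v) \<and> ext v i - ext v j \<in> {0, 1}})"

definition defc :: "int list \<Rightarrow> int" where
  "defc v = int (length v choose 2) - area v - dinv v"


section \<open>Integer partitions as Dyck classes\<close>

text \<open>A partition is the weakly decreasing list of its positive parts; \<open>[]\<close> is the
  zero partition.\<close>

definition partitions :: "nat list set" where
  "partitions = {\<gamma>. sorted_wrt (\<ge>) \<gamma> \<and> 0 \<notin> set \<gamma>}"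

definition part :: "nat list \<Rightarrow> nat \<Rightarrow> nat" where
  "part \<gamma> i = (if 1 \<le> i \<and> i \<le> length \<gamma> then \<gamma> ! (i - 1) else 0)"

definition qdv_of :: "nat \<Rightarrow> nat list \<Rightarrow> int list" where
  "qdv_of n \<gamma> = map (\<lambda>i. int i - int (part \<gamma> (n - i))) [0..<n]"

definition class_of :: "nat list \<Rightarrow> int list set" where
  "class_of \<gamma> = {qdv_of n \<gamma> | n. n > length \<gamma>}"

text \<open>Both statistics are constant on each Dyck class; this is their common value there.\<close>

definition dinv_part :: "nat list \<Rightarrow> int" where
  "dinv_part \<gamma> = (THE d. \<forall>v \<in> class_of \<gamma>. dinv v = d)"

definition defc_part :: "nat list \<Rightarrow> int" where
  "defc_part \<gamma> = (THE d. \<forall>v \<in> class_of \<gamma>. defc v = d)"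


section \<open>The first map\<close>

definition D1 :: "nat list set" where
  "D1 = {\<gamma> \<in> partitions. part \<gamma> 1 \<le> length \<gamma> + 2}"

definition C1 :: "nat list set" where
  "C1 = {\<gamma> \<in> partitions. \<gamma> \<noteq> [] \<and> part \<gamma> 1 \<ge> length \<gamma>}"

definition NU1 :: "nat list \<Rightarrow> nat list" where
  "NU1 \<gamma> = filter (\<lambda>x. x > 0) ((length \<gamma> + 1) # map (\<lambda>x. x - 1) \<gamma>)"

definition ND1 :: "nat list \<Rightarrow> nat list" where
  "ND1 \<gamma> = map (\<lambda>x. x + 1) (tl \<gamma>) @ replicate (part \<gamma> 1 - length \<gamma>) 1"


section \<open>The second map\<close>

text \<open>\<open>NU2_template u w\<close>: the rule sends the Dyck class of the word \<open>u\<close> to that of \<open>w\<close>.\<close>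

inductive NU2_template :: "int list \<Rightarrow> int list \<Rightarrow> bool" where
  rule_a: "h \<ge> 2 \<Longrightarrow>
     A = [] \<or> (\<forall>a \<in> set A. a \<le> 2) \<and> last A \<ge> 0 \<and> slow_growth A \<Longrightarrow>
     NU2_template
       ([0, 1] @ replicate h 2 @ A @ replicate (h - 1) (- 1))
       ([0] @ replicate (h - 1) 0 @ [1] @ A @ replicate h 1)"
| rule_b: "k \<ge> 1 \<Longrightarrow>
     B = [] \<or> (\<forall>b \<in> set B. b \<le> 2) \<and> hd B \<le> 1 \<and> last B \<ge> - 1 \<and> slow_growth B \<Longrightarrow>
     NU2_template
       ([0, 1] @ replicate k 2 @ B @ replicate k (- 1))
       ([0] @ replicate k 0 @ B @ [0] @ replicate k 1)"

definition D2 :: "nat list set" where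
  "D2 = {\<gamma> \<in> partitions. \<exists>u w. NU2_template u w \<and> class_of \<gamma> = dyck_class u}"

definition C2 :: "nat list set" where
  "C2 = {\<delta> \<in> partitions. \<exists>u w. NU2_template u w \<and> class_of \<delta> = dyck_class w}"

definition NU2_graph :: "nat list \<Rightarrow> nat list \<Rightarrow> bool" where
  "NU2_graph \<gamma> \<delta> \<longleftrightarrow> \<gamma> \<in> partitions \<and> \<delta> \<in> partitions \<and>
     (\<exists>u w. NU2_template u w \<and> class_of \<gamma> = dyck_class u \<and> class_of \<delta> = dyck_class w)"


section \<open>The extended maps\<close>

definition D :: "nat list set" where
  "D = D1 \<union> D2"

definition C :: "nat list set" where
  "C = C1 \<union> C2"

text \<open>The prescriptions for the two maps are recorded as relations, because it is part of
  the theorem that they are single-valued: a class may match a template in several ways,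
  or lie in the domains of both maps.\<close>

definition NU_graph :: "nat list \<Rightarrow> nat list \<Rightarrow> bool" where
  "NU_graph \<gamma> \<delta> \<longleftrightarrow> \<gamma> \<in> D1 \<and> \<delta> = NU1 \<gamma> \<or> NU2_graph \<gamma> \<delta>"

definition ND_graph :: "nat list \<Rightarrow> nat list \<Rightarrow> bool" where
  "ND_graph \<gamma> \<delta> \<longleftrightarrow> \<gamma> \<in> C1 \<and> \<delta> = ND1 \<gamma> \<or> NU2_graph \<delta> \<gamma>"

definition NU :: "nat list \<Rightarrow> nat list" where
  "NU \<gamma> = (THE \<delta>. NU_graph \<gamma> \<delta>)"

definition ND :: "nat list \<Rightarrow> nat list" where
  "ND \<gamma> = (THE \<delta>. ND_graph \<gamma> \<delta>)"

end

theory Submission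
  imports Defs
begin

text \<open>Every class matching an input template has \<open>\<gamma>\<^sub>1 = \<ell>(\<gamma>) + 3\<close>, and every class matching an
  output template has \<open>\<gamma>\<^sub>1 < \<ell>(\<gamma>)\<close>, so the second map never meets the first. The rule and its
  parameter can be recovered from the runs at the two ends of either word, so the second map is
  single-valued and injective. On vectors, \<open>NU\<^sub>1\<close> is \<open>0 y \<mapsto> 0 y\<^sup>+ 0\<close>. Since \<open>defc\<close> is the size of the
  partition minus \<open>dinv\<close>, it remains to count that each step raises \<open>dinv\<close> and the size by one;
  the growth of \<open>dinv\<close> also excludes repetitions.\<close>

section \<open>Partitions, their vectors and Dyck classes\<close>

lemma part_pos_iff: "\<gamma> \<in> partitions \<Longrightarrow> 0 < part \<gamma> i \<longleftrightarrow> 1 \<le> i \<and> i \<le> length \<gamma>"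
  by (auto simp: partitions_def part_def intro!: gr0I) (metis One_nat_def Suc_pred less_eq_Suc_le nth_mem)

lemma part_eq_0_iff: "\<gamma> \<in> partitions \<Longrightarrow> part \<gamma> i = 0 \<longleftrightarrow> i = 0 \<or> length \<gamma> < i"
  using part_pos_iff[of \<gamma> i] by linarith

lemma part_antimono:
  assumes "\<gamma> \<in> partitions" "1 \<le> i" "i \<le> j"
  shows "part \<gamma> j \<le> part \<gamma> i"
proof (cases "i = j \<or> j > length \<gamma>")
  case False
  then show ?thesis
    using assms by (auto simp: partitions_def part_def sorted_wrt_iff_nth_less)
qed (use assms in \<open>auto simp: part_def\<close>)

lemma length_qdv_of [simp]: "length (qdv_of n \<gamma>) = n"
  by (simp add: qdv_of_def)

lemma nth_qdv_of [simp]: "i < n \<Longrightarrow> qdv_of n \<gamma> ! i = int i - int (part \<gamma> (n - i))"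
  by (simp add: qdv_of_def)

lemma length_plus1 [simp]: "length (plus1 v) = length v"
  by (simp add: plus1_def)

lemma qdv_of_in_QDV:
  assumes "\<gamma> \<in> partitions" "length \<gamma> < n"
  shows "qdv_of n \<gamma> \<in> QDV"
proof -
  have "slow_growth (qdv_of n \<gamma>)"
    unfolding slow_growth_def successively_conv_nth
  proof (intro allI impI)
    fix i assume "Suc i < length (qdv_of n \<gamma>)"
    then have "Suc i < n" by simp
    moreover have "part \<gamma> (n - i) \<le> part \<gamma> (n - Suc i)"
      by (rule part_antimono) (use assms calculation in auto)
    ultimately show "qdv_of n \<gamma> ! Suc i \<le> qdv_of n \<gamma> ! i + 1"
      by simp
  qed
  moreover have "qdv_of n \<gamma> \<noteq> []" using assms by (simp flip: length_0_conv)
  moreover have "hd (qdv_of n \<gamma>) = 0"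
    using assms calculation(2) by (simp add: hd_conv_nth part_eq_0_iff)
  ultimately show ?thesis by (simp add: QDV_def)
qed

text \<open>The new first entry is 0 because part \<open>Suc n\<close> vanishes; every other entry
  keeps its part while its index grows by one. So a generating step of \<open>dyck_equiv\<close> is
  a unit step in \<open>n\<close>.\<close>

lemma qdv_of_Suc:
  assumes "length \<gamma> \<le> n"
  shows "qdv_of (Suc n) \<gamma> = 0 # plus1 (qdv_of n \<gamma>)"
proof (rule nth_equalityI)
  fix i assume "i < length (qdv_of (Suc n) \<gamma>)"
  then show "qdv_of (Suc n) \<gamma> ! i = (0 # plus1 (qdv_of n \<gamma>)) ! i"
    using assms by (cases i) (auto simp: plus1_def part_def)
qed simp

lemma inj_plus1: "inj plus1"
  by (rule injI) (auto simp: plus1_def inj_def dest!: map_injective)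

text \<open>Both directions are wanted because the equivalence closure also runs the generating step
  backwards.\<close>

lemma class_of_shift_iff:
  assumes "\<gamma> \<in> partitions" "v \<in> QDV"
  shows "0 # plus1 v \<in> class_of \<gamma> \<longleftrightarrow> v \<in> class_of \<gamma>"
proof
  assume "v \<in> class_of \<gamma>"
  then obtain n where "n > length \<gamma>" "v = qdv_of n \<gamma>" by (auto simp: class_of_def)
  then show "0 # plus1 v \<in> class_of \<gamma>"
    using qdv_of_Suc[of \<gamma> n] by (auto simp: class_of_def intro!: exI[of _ "Suc n"])
next
  assume "0 # plus1 v \<in> class_of \<gamma>"
  then obtain m where m: "m > length \<gamma>" "0 # plus1 v = qdv_of m \<gamma>" by (auto simp: class_of_def)
  obtain n where n: "m = Suc n" using m by (cases m) auto
  have nn: "v \<noteq> []" "length v = n"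
    using assms(2) arg_cong[OF m(2), of length] n by (auto simp: QDV_def)
  then have "n > 0" by auto
  \<comment> \<open>Since \<open>v\<close> starts with 0, the shifted vector has 1 at index 1. This
    forces \<open>part \<gamma> n = 0\<close>, so length \<open>n\<close> is still large enough for
    a member of the class.\<close>
  have "plus1 v ! 0 = 1" using nn assms \<open>n > 0\<close> by (auto simp: plus1_def QDV_def hd_conv_nth)
  then have "qdv_of m \<gamma> ! 1 = 1" by (simp flip: m(2))
  then have "part \<gamma> n = 0" using n \<open>n > 0\<close> by simp
  then have l: "n > length \<gamma>" using assms \<open>n > 0\<close> by (simp add: part_eq_0_iff)
  then have "plus1 v = plus1 (qdv_of n \<gamma>)" using m n qdv_of_Suc[of \<gamma> n] by simp
  then have "v = qdv_of n \<gamma>" using inj_plus1 by (simp add: inj_def)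
  then show "v \<in> class_of \<gamma>" using l by (auto simp: class_of_def)
qed

lemma class_of_subset_QDV: "\<gamma> \<in> partitions \<Longrightarrow> class_of \<gamma> \<subseteq> QDV"
  by (auto simp: class_of_def qdv_of_in_QDV)

lemma dyck_equiv_refl: "dyck_equiv v v"
  by (simp add: dyck_equiv_def)

lemma dyck_equiv_trans: "dyck_equiv u v \<Longrightarrow> dyck_equiv v w \<Longrightarrow> dyck_equiv u w"
  unfolding dyck_equiv_def by (rule equivclp_trans)

lemma dyck_equiv_sym: "dyck_equiv u v \<Longrightarrow> dyck_equiv v u"
  unfolding dyck_equiv_def by (rule equivclp_sym)

lemma class_of_closed:
  assumes "\<gamma> \<in> partitions" "dyck_equiv u v" "u \<in> class_of \<gamma>"
  shows "v \<in> class_of \<gamma>"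
  using assms(2,3) unfolding dyck_equiv_def
  by (induction rule: equivclp_induct) (auto simp: class_of_shift_iff[OF assms(1)])

lemma dyck_equiv_qdv_of:
  assumes "\<gamma> \<in> partitions" "length \<gamma> < n"
  shows "dyck_equiv (qdv_of (Suc (length \<gamma>)) \<gamma>) (qdv_of n \<gamma>)"
  using assms(2)
proof (induction n)
  case (Suc n)
  show ?case
  proof (cases "length \<gamma> < n")
    case True
    have "dyck_equiv (qdv_of n \<gamma>) (qdv_of (Suc n) \<gamma>)"
      unfolding dyck_equiv_def using True assms
      by (intro r_into_equivclp) (simp add: qdv_of_Suc qdv_of_in_QDV)
    then show ?thesis using Suc.IH True dyck_equiv_trans by blast
  next
    case False
    then have "n = length \<gamma>" using Suc.prems by simp
    then show ?thesis by (simp add: dyck_equiv_refl)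
  qed
qed simp

text \<open>\<open>class_of \<gamma>\<close> is closed under \<open>dyck_equiv\<close>, and any two
  of its members are linked through the shortest one. Hence equality of classes reduces to
  membership of one representative.\<close>

lemma class_of_eq_dyck_class_iff:
  assumes "\<gamma> \<in> partitions" "u \<in> QDV"
  shows "class_of \<gamma> = dyck_class u \<longleftrightarrow> u \<in> class_of \<gamma>"
proof
  assume "class_of \<gamma> = dyck_class u"
  then show "u \<in> class_of \<gamma>" using assms by (simp add: dyck_class_def dyck_equiv_refl)
next
  assume u: "u \<in> class_of \<gamma>"
  show "class_of \<gamma> = dyck_class u"
  proof
    show "dyck_class u \<subseteq> class_of \<gamma>"
      using class_of_closed[OF assms(1) _ u] by (auto simp: dyck_class_def)
    show "class_of \<gamma> \<subseteq> dyck_class u"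
    proof
      fix v assume v: "v \<in> class_of \<gamma>"
      then have "dyck_equiv u v"
        using u dyck_equiv_qdv_of[OF assms(1)] dyck_equiv_sym dyck_equiv_trans
        unfolding class_of_def by blast
      then show "v \<in> dyck_class u"
        using v class_of_subset_QDV[OF assms(1)] by (auto simp: dyck_class_def)
    qed
  qed
qed

section \<open>Every vector belongs to exactly one partition\<close>

lemma partition_eqI:
  assumes "\<gamma> \<in> partitions" "\<delta> \<in> partitions" "\<And>i. 1 \<le> i \<Longrightarrow> part \<gamma> i = part \<delta> i"
  shows "\<gamma> = \<delta>"
proof -
  have "1 \<le> i \<and> i \<le> length \<gamma> \<longleftrightarrow> 1 \<le> i \<and> i \<le> length \<delta>" for i
    using part_pos_iff[OF assms(1), of i] part_pos_iff[OF assms(2), of i] assms(3)[of i] by auto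
  from this[of "length \<gamma>"] this[of "length \<delta>"] have l: "length \<gamma> = length \<delta>"
    by linarith
  show ?thesis
  proof (rule nth_equalityI)
    fix i assume "i < length \<gamma>"
    then show "\<gamma> ! i = \<delta> ! i" using assms(3)[of "Suc i"] l by (simp add: part_def)
  qed (rule l)
qed

text \<open>The length of \<open>u\<close> fixes \<open>n\<close>, and its entries read from the
  right then give all parts up to index \<open>n\<close>; the later ones vanish.\<close>

lemma class_of_unique:
  assumes "\<gamma> \<in> partitions" "\<delta> \<in> partitions" "u \<in> class_of \<gamma>" "u \<in> class_of \<delta>"
  shows "\<gamma> = \<delta>"
proof (rule partition_eqI[OF assms(1,2)])
  fix i :: nat assume i: "1 \<le> i"
  obtain n where n: "u = qdv_of n \<gamma>" "u = qdv_of n \<delta>" "length \<gamma> < n" "length \<delta> < n"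
  proof -
    obtain m n where mn: "u = qdv_of n \<gamma>" "u = qdv_of m \<delta>" "length \<gamma> < n" "length \<delta> < m"
      using assms(3,4) unfolding class_of_def by blast
    from arg_cong[OF mn(1), of length] arg_cong[OF mn(2), of length] have "m = n" by simp
    then show thesis using mn by (intro that[of n]) simp_all
  qed
  show "part \<gamma> i = part \<delta> i"
  proof (cases "i \<le> n")
    case True
    have "qdv_of n \<gamma> ! (n - i) = qdv_of n \<delta> ! (n - i)" by (simp only: n(1)[symmetric] n(2)[symmetric])
    then show ?thesis using True i by simp
  qed (use n(3,4) in \<open>simp add: part_def\<close>)
qed

lemma part_Cons: "part (x # xs) i = (if i = 0 then 0 else if i = 1 then x else part xs (i - 1))"
  by (auto simp: part_def nth_Cons')

text \<open>In a weakly decreasing list the zeros stand at the end, where \<open>part\<close>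
  returns the default value 0 anyway.\<close>

lemma part_filter_pos:
  assumes "sorted_wrt (\<ge>) xs"
  shows "part (filter (\<lambda>x. x > 0) xs) i = part xs i"
  using assms
proof (induction xs arbitrary: i)
  case (Cons x xs)
  show ?case
  proof (cases "x > 0")
    case True
    then show ?thesis using Cons by (simp add: part_Cons)
  next
    case False
    then have "\<forall>y\<in>set xs. y = 0" using Cons.prems by auto
    then have "filter (\<lambda>x. x > 0) xs = []" "part xs j = 0" for j
      by (auto simp: part_def filter_empty_conv)
    then show ?thesis using False by (simp add: part_Cons) (simp add: part_def)
  qed
qed simp

lemma filter_pos_in_partitions:
  "sorted_wrt (\<ge>) xs \<Longrightarrow> filter (\<lambda>x. x > 0) xs \<in> partitions"
  by (auto simp: partitions_def sorted_wrt_filter)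

lemma QDV_le_add:
  assumes "slow_growth v" "i + k < length v"
  shows "v ! (i + k) \<le> v ! i + int k"
  using assms(2)
proof (induction k)
  case (Suc k)
  then have "v ! Suc (i + k) \<le> v ! (i + k) + 1"
    using assms(1) by (simp add: slow_growth_def successively_conv_nth)
  then show ?case using Suc by simp
qed simp

lemma ex_class_of:
  assumes "u \<in> QDV"
  obtains \<gamma> where "\<gamma> \<in> partitions" "u \<in> class_of \<gamma>"
proof -
  let ?n = "length u"
  \<comment> \<open>Solving the formula of \<open>qdv_of\<close> for the parts. The entry at index 0
    is left out: it is 0 and would only give a zero part. This keeps the length below
    \<open>?n\<close>.\<close>
  define xs where "xs = map (\<lambda>j. nat (int (?n - Suc j) - u ! (?n - Suc j))) [0..<?n - 1]"
  have n: "0 < ?n" and u0: "u ! 0 = 0" and sl: "slow_growth u"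
    using assms by (auto simp: QDV_def hd_conv_nth)
  have srt: "sorted_wrt (\<ge>) xs"
    unfolding sorted_wrt_iff_nth_less
  proof (intro allI impI)
    fix i j assume ij: "i < j" "j < length xs"
    then have "u ! ((?n - Suc j) + (j - i)) \<le> u ! (?n - Suc j) + int (j - i)"
      by (intro QDV_le_add sl) (auto simp: xs_def)
    moreover have "?n - Suc j + (j - i) = ?n - Suc i" using ij by (auto simp: xs_def)
    ultimately show "xs ! j \<le> xs ! i" using ij by (auto simp: xs_def)
  qed
  define \<gamma> where "\<gamma> = filter (\<lambda>x. x > 0) xs"
  have "length \<gamma> \<le> length xs" by (simp add: \<gamma>_def)
  also have "length xs < ?n" using n by (simp add: xs_def)
  finally have l: "length \<gamma> < ?n" .
  have "u = qdv_of ?n \<gamma>"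
  proof (rule nth_equalityI)
    fix i assume i: "i < ?n"
    have p: "part \<gamma> (?n - i) = part xs (?n - i)" using part_filter_pos[OF srt] by (simp add: \<gamma>_def)
    \<comment> \<open>Ensures that \<open>nat\<close> does not truncate the part read off at this
      entry.\<close>
    have le: "u ! i \<le> int i" using QDV_le_add[OF sl, of 0 i] i u0 by simp
    show "u ! i = qdv_of ?n \<gamma> ! i"
    proof (cases i)
      case 0
      have "part xs ?n = 0" unfolding part_def xs_def using n by auto
      then show ?thesis using 0 n u0 p by simp
    next
      case (Suc i')
      obtain m where m: "?n = Suc (i + m)" using i less_imp_Suc_add by blast
      then have "xs ! m = nat (int i - u ! i)" "m < length xs" using Suc by (auto simp: xs_def simp del: upt_Suc)
      then have "part xs (?n - i) = nat (int i - u ! i)" using m by (simp add: part_def)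
      then show ?thesis using i p le by simp
    qed
  qed simp
  then have "u \<in> class_of \<gamma>" using l unfolding class_of_def by blast
  moreover have "\<gamma> \<in> partitions" unfolding \<gamma>_def by (rule filter_pos_in_partitions[OF srt])
  ultimately show ?thesis using that by blast
qed

section \<open>Additive formulas for \<open>dinv\<close>\<close>

text \<open>The number of positions \<open>i \<le> 0\<close> of the extended vector that form a
  \<open>dinv\<close> pair with an entry \<open>x\<close>: the candidates are \<open>x + 1\<close>
  and \<open>x + 2\<close>.\<close>

definition neg_attacks :: "int \<Rightarrow> int" where
  "neg_attacks x = (if x \<le> - 2 then 2 else if x = - 1 then 1 else 0)"

text \<open>The number of \<open>dinv\<close> pairs that an entry \<open>x\<close> forms with the
  entries of \<open>v\<close> when it is placed after them.\<close>

definition attacks :: "int list \<Rightarrow> int \<Rightarrow> int" where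
  "attacks v x = int (count_list v x) + int (count_list v (x + 1))"

text \<open>The number of \<open>dinv\<close> pairs with first position in \<open>v\<close> and
  second in \<open>w\<close>, for the word \<open>v @ w\<close>.\<close>

definition cross_dinv :: "int list \<Rightarrow> int list \<Rightarrow> int" where
  "cross_dinv v w = (\<Sum>x\<leftarrow>w. attacks v x)"

lemma card_neg_attacks:
  "int (card {i. i \<le> 0 \<and> (i - 1) - x \<in> {0, 1::int}}) = neg_attacks x"
proof -
  have "{i. i \<le> 0 \<and> (i - 1) - x \<in> {0, 1::int}} =
    (if x \<le> - 2 then {x + 1, x + 2} else if x = - 1 then {0} else {})"
    by auto
  then show ?thesis by (simp add: neg_attacks_def)
qed

lemma finite_neg_attacks: "finite {i. i \<le> 0 \<and> (i - 1) - x \<in> {0, 1::int}}"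
  by (rule finite_subset[of _ "{x + 1, x + 2}"]) auto

lemma card_attacks:
  "int (card {i. 0 < i \<and> i \<le> int (length v) \<and> ext v i - x \<in> {0, 1::int}}) = attacks v x"
proof -
  have "{i. 0 < i \<and> i \<le> int (length v) \<and> ext v i - x \<in> {0, 1::int}} =
    (\<lambda>j. int j + 1) ` {j. j < length v \<and> (v ! j = x \<or> v ! j = x + 1)}"
  proof (intro set_eqI iffI)
    fix i assume i: "i \<in> {i. 0 < i \<and> i \<le> int (length v) \<and> ext v i - x \<in> {0, 1::int}}"
    then have "i = int (nat (i - 1)) + 1" by simp
    moreover have "nat (i - 1) \<in> {j. j < length v \<and> (v ! j = x \<or> v ! j = x + 1)}"
      using i by (auto simp: ext_def)
    ultimately show "i \<in> (\<lambda>j. int j + 1) ` {j. j < length v \<and> (v ! j = x \<or> v ! j = x + 1)}"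
      by blast
  qed (auto simp: ext_def)
  moreover have "inj_on (\<lambda>j. int j + 1) S" for S by (auto simp: inj_on_def)
  ultimately have "card {i. 0 < i \<and> i \<le> int (length v) \<and> ext v i - x \<in> {0, 1::int}} =
    length (filter (\<lambda>y. y = x \<or> y = x + 1) v)"
    by (simp add: card_image length_filter_conv_card)
  also have "\<dots> = count_list v x + count_list v (x + 1)"
    by (induction v) auto
  finally show ?thesis by (simp add: attacks_def)
qed

lemma finite_attacks: "finite {i. 0 < i \<and> i \<le> int (length v) \<and> ext v i - x \<in> {0, 1::int}}"
  by (rule finite_subset[of _ "{0..int (length v)}"]) auto

definition dinv_pairs :: "int list \<Rightarrow> (int \<times> int) set" where
  "dinv_pairs v = {(i, j). i < j \<and> j \<le> int (length v) \<and> ext v i - ext v j \<in> {0, 1}}"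

lemma dinv_conv_pairs: "dinv v = int (card (dinv_pairs v))"
  by (simp add: dinv_def dinv_pairs_def)

lemma dinv_pairs_Nil [simp]: "dinv_pairs [] = {}"
  by (auto simp: dinv_pairs_def ext_def)

lemma dinv_Nil [simp]: "dinv [] = 0"
  by (simp add: dinv_conv_pairs)

text \<open>Appending leaves the extension unchanged at earlier positions, so every new pair ends at
  the new position. The partners are split by sign of their index, as the two kinds are counted
  differently.\<close>

lemma dinv_pairs_snoc:
  "dinv_pairs (v @ [x]) = dinv_pairs v \<union>
     (\<lambda>i. (i, int (length v) + 1)) `
       ({i. i \<le> 0 \<and> (i - 1) - x \<in> {0, 1}} \<union>
        {i. 0 < i \<and> i \<le> int (length v) \<and> ext v i - x \<in> {0, 1}})"
proof -
  have 1: "ext (v @ [x]) i = ext v i" if "i \<le> int (length v)" for i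
    using that by (auto simp: ext_def nth_append)
  have 2: "ext (v @ [x]) (int (length v) + 1) = x"
    by (simp add: ext_def)
  have 3: "ext v i = i - 1" if "i \<le> 0" for i using that by (simp add: ext_def)
  have "(i, j) \<in> dinv_pairs (v @ [x]) \<longleftrightarrow> (i, j) \<in> dinv_pairs v \<union>
     (\<lambda>i. (i, int (length v) + 1)) `
       ({i. i \<le> 0 \<and> (i - 1) - x \<in> {0, 1}} \<union>
        {i. 0 < i \<and> i \<le> int (length v) \<and> ext v i - x \<in> {0, 1}})" for i j
  proof (cases "j \<le> int (length v)")
    case True
    then show ?thesis by (auto simp: dinv_pairs_def 1)
  next
    case False
    then show ?thesis
      using 1[of i] 2 3[of i]
      by (cases "j = int (length v) + 1"; cases "i \<le> int (length v)"; cases "i \<le> 0")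
        (simp_all add: dinv_pairs_def image_iff)
  qed
  then show ?thesis by auto
qed

lemma finite_dinv_pairs: "finite (dinv_pairs v)"
proof (induction v rule: rev_induct)
  case (snoc x v)
  then show ?case
    using finite_neg_attacks finite_attacks by (simp add: dinv_pairs_snoc)
qed simp

lemma dinv_snoc: "dinv (v @ [x]) = dinv v + neg_attacks x + attacks v x"
proof -
  let ?N = "{i. i \<le> 0 \<and> (i - 1) - x \<in> {0, 1::int}}"
  let ?P = "{i. 0 < i \<and> i \<le> int (length v) \<and> ext v i - x \<in> {0, 1}}"
  have "card (dinv_pairs (v @ [x])) =
    card (dinv_pairs v) + card ((\<lambda>i. (i, int (length v) + 1)) ` (?N \<union> ?P))"
    unfolding dinv_pairs_snoc
    by (rule card_Un_disjoint)
      (use finite_neg_attacks finite_attacks finite_dinv_pairs in \<open>auto simp: dinv_pairs_def\<close>)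
  also have "card ((\<lambda>i. (i, int (length v) + 1)) ` (?N \<union> ?P)) = card (?N \<union> ?P)"
    by (rule card_image) (auto simp: inj_on_def)
  also have "card (?N \<union> ?P) = card ?N + card ?P"
    by (rule card_Un_disjoint[OF finite_neg_attacks finite_attacks]) auto
  finally show ?thesis
    using card_neg_attacks[of x] card_attacks[of v x] by (simp add: dinv_conv_pairs)
qed

lemma attacks_append: "attacks (v @ w) x = attacks v x + attacks w x"
  by (simp add: attacks_def)

lemma count_list_replicate_if: "count_list (replicate k c) x = (if x = c then k else 0)"
  by (induction k) auto

lemma attacks_plus1: "attacks (plus1 v) (x + 1) = attacks v x"
proof -
  have "count_list (plus1 v) (y + 1) = count_list v y" for y
    by (induction v) (auto simp: plus1_def)
  from this[of x] this[of "x + 1"] show ?thesis by (simp add: attacks_def)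
qed

text \<open>With these rules the cross terms between constant blocks and a free list become linear
  in the counts of single values in that list.\<close>

lemma cross_dinv_simps:
  "cross_dinv [] w = 0"
  "cross_dinv v [] = 0"
  "cross_dinv v (w @ w') = cross_dinv v w + cross_dinv v w'"
  "cross_dinv (v @ v') w = cross_dinv v w + cross_dinv v' w"
  "cross_dinv v (replicate k c) = int k * attacks v c"
  "cross_dinv (replicate k c) w = int k * (int (count_list w c) + int (count_list w (c - 1)))"
proof -
  show "cross_dinv [] w = 0" by (induction w) (auto simp: cross_dinv_def attacks_def)
  show "cross_dinv (v @ v') w = cross_dinv v w + cross_dinv v' w"
    by (simp add: cross_dinv_def attacks_append sum_list_addf)
  show "cross_dinv v (replicate k c) = int k * attacks v c"
    by (induction k) (auto simp: cross_dinv_def algebra_simps)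
  show "cross_dinv (replicate k c) w = int k * (int (count_list w c) + int (count_list w (c - 1)))"
    by (induction w) (auto simp: cross_dinv_def attacks_def count_list_replicate_if algebra_simps)
qed (simp_all add: cross_dinv_def)

text \<open>Pairs with positions \<open>i \<le> 0\<close> depend only on the value of the later
  entry, not on where it stands. They are thus already counted in \<open>dinv v\<close> and
  \<open>dinv w\<close>.\<close>

lemma dinv_append: "dinv (v @ w) = dinv v + dinv w + cross_dinv v w"
proof (induction w rule: rev_induct)
  case (snoc x w)
  then show ?case
    by (simp add: dinv_snoc attacks_append cross_dinv_def flip: append_assoc)
qed (simp add: cross_dinv_def)

lemma dinv_replicate:
  "dinv (replicate k c) = int k * neg_attacks c + int (k choose 2)"
proof (induction k)
  case (Suc k)
  have "dinv (replicate (Suc k) c) = dinv (replicate k c @ [c])"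
    by (simp add: replicate_append_same)
  also have "\<dots> = dinv (replicate k c) + neg_attacks c + int k"
    by (simp only: dinv_snoc) (simp add: attacks_def count_list_replicate_if)
  finally show ?case using Suc by (simp add: algebra_simps numeral_2_eq_2)
qed simp

lemma dinv_singleton: "dinv [c] = neg_attacks c"
  using dinv_snoc[of "[]" c] by (simp add: attacks_def)

lemma cross_dinv_singleton:
  "cross_dinv [c] w = int (count_list w c) + int (count_list w (c - 1))"
  using cross_dinv_simps(6)[of 1 c w] by simp

lemma cross_dinv_Cons_right: "cross_dinv v (c # w) = attacks v c + cross_dinv v w"
  by (simp add: cross_dinv_def)

lemma dinv_Cons:
  "dinv (c # w) = neg_attacks c + dinv w + int (count_list w c) + int (count_list w (c - 1))"
  using dinv_append[of "[c]" w] by (simp add: dinv_singleton cross_dinv_singleton)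

text \<open>Pairs inside the word survive a common shift. An entry loses a partner at positions
  \<open>i \<le> 0\<close>, namely exactly one, just when it is -1 or -2.\<close>

lemma dinv_plus1:
  "dinv (plus1 w) + int (count_list w (- 1)) + int (count_list w (- 2)) = dinv w"
proof (induction w rule: rev_induct)
  case (snoc x w)
  have "plus1 (w @ [x]) = plus1 w @ [x + 1]" by (simp add: plus1_def)
  then show ?case using snoc
    by (auto simp: dinv_snoc attacks_plus1 neg_attacks_def)
qed (simp add: plus1_def)

lemma count_list_plus1: "count_list (plus1 w) x = count_list w (x - 1)"
  by (induction w) (auto simp: plus1_def)

text \<open>The prepended 0 pairs with the entries 0 and -1 of \<open>plus1 v\<close>, which
  replaces exactly the pairs lost by the shift.\<close>

lemma dinv_shift: "dinv (0 # plus1 v) = dinv v"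
  using dinv_plus1[of v] by (simp add: dinv_Cons neg_attacks_def count_list_plus1)

text \<open>This is the first map on vectors. The last 0 pairs with the shifted copies of the
  entries -1 and 0 of \<open>y\<close>, as many as the first 0 of \<open>0 # y\<close> does; the
  pair of the two outer zeros is the extra one.\<close>

lemma dinv_cycle: "dinv (0 # plus1 y @ [0]) = dinv (0 # y) + 1"
proof -
  have "dinv (0 # plus1 y @ [0]) = dinv ((0 # plus1 y) @ [0])" by simp
  also have "\<dots> = dinv y + int (count_list y 0) + int (count_list y (- 1)) + 1"
    by (simp only: dinv_snoc dinv_shift)
      (simp add: neg_attacks_def attacks_def count_list_plus1)
  also have "\<dots> = dinv (0 # y) + 1"
    by (simp add: dinv_Cons neg_attacks_def)
  finally show ?thesis .
qed

section \<open>Statistics of partitions\<close>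

text \<open>The size of the partition: the entries of \<open>qdv_of n \<gamma>\<close> are the
  indices 0 to \<open>n - 1\<close> minus the parts. So \<open>defc\<close> is \<open>coarea\<close>
  minus \<open>dinv\<close>.\<close>

definition coarea :: "int list \<Rightarrow> int" where
  "coarea v = int (length v choose 2) - area v"

lemma coarea_shift: "coarea (0 # plus1 v) = coarea v"
  by (simp add: coarea_def area_def plus1_def sum_list_addf sum_list_triv numeral_2_eq_2 comp_def)

lemma coarea_cycle: "coarea (0 # plus1 y @ [0]) = coarea (0 # y) + 1"
  by (simp add: coarea_def area_def plus1_def sum_list_addf sum_list_triv numeral_2_eq_2 comp_def)

text \<open>Both statistics are invariant under the shift, hence along all lengths \<open>n\<close>;
  so the definite descriptions denote, and any member computes them.\<close>

lemma stats_part: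
  assumes "v \<in> class_of \<gamma>"
  shows "dinv_part \<gamma> = dinv v" "defc_part \<gamma> = coarea v - dinv v"
proof -
  have *: "dinv (qdv_of n \<gamma>) = dinv (qdv_of (Suc (length \<gamma>)) \<gamma>) \<and>
    coarea (qdv_of n \<gamma>) = coarea (qdv_of (Suc (length \<gamma>)) \<gamma>)" if "length \<gamma> < n" for n
    using that
  proof (induction n)
    case (Suc n)
    show ?case
    proof (cases "n = length \<gamma>")
      case False
      then show ?thesis using Suc
        by (simp add: qdv_of_Suc[of \<gamma> n] dinv_shift coarea_shift)
    qed simp
  qed simp
  have eq: "dinv w = dinv v \<and> coarea w = coarea v" if w: "w \<in> class_of \<gamma>" for w
  proof -
    obtain m n where "w = qdv_of m \<gamma>" "length \<gamma> < m" "v = qdv_of n \<gamma>" "length \<gamma> < n"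
      using w assms unfolding class_of_def by blast
    then show ?thesis using *[of m] *[of n] by simp
  qed
  show "dinv_part \<gamma> = dinv v"
    unfolding dinv_part_def by (rule the_equality) (use assms eq in metis)+
  show "defc_part \<gamma> = coarea v - dinv v"
    unfolding defc_part_def defc_def coarea_def[symmetric]
    by (rule the_equality) (use assms eq in metis)+
qed

section \<open>The second map on words\<close>

text \<open>Pairs involving the free middle list contribute equally to both words, and so do those
  inside it; what remains is a count over the explicit blocks. Writing the parameter as a successor
  removes the truncated subtraction.\<close>

lemma NU2_template_dinv: "NU2_template u w \<Longrightarrow> dinv w = dinv u + 1"
proof (induction rule: NU2_template.induct)
  case (rule_a h A)
  then obtain g where "h = Suc g" by (cases h) auto
  then show ?case
    by (simp add: dinv_append dinv_Cons dinv_replicate cross_dinv_simps cross_dinv_singleton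
        cross_dinv_Cons_right attacks_def count_list_replicate_if neg_attacks_def
        numeral_2_eq_2 algebra_simps)
next
  case (rule_b k B)
  then obtain g where "k = Suc g" by (cases k) auto
  then show ?case
    by (simp add: dinv_append dinv_Cons dinv_replicate cross_dinv_simps cross_dinv_singleton
        cross_dinv_Cons_right attacks_def count_list_replicate_if neg_attacks_def
        numeral_2_eq_2 algebra_simps)
qed

text \<open>Both words have the same length, and the sum of the entries drops by one: from
  \<open>h + 2\<close> to \<open>h + 1\<close>, or from \<open>k + 1\<close> to \<open>k\<close>,
  apart from the middle list.\<close>

lemma NU2_template_coarea: "NU2_template u w \<Longrightarrow> coarea w = coarea u + 1"
proof (induction rule: NU2_template.induct)
  case (rule_a h A)
  then obtain g where "h = Suc g" by (cases h) auto
  then show ?case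
    by (simp add: coarea_def area_def sum_list_replicate algebra_simps)
next
  case (rule_b k B)
  then obtain g where "k = Suc g" by (cases k) auto
  then show ?case
    by (simp add: coarea_def area_def sum_list_replicate algebra_simps)
qed

lemma slow_growth_append:
  "slow_growth (xs @ ys) \<longleftrightarrow>
     slow_growth xs \<and> slow_growth ys \<and> (xs = [] \<or> ys = [] \<or> hd ys \<le> last xs + 1)"
  by (auto simp: slow_growth_def successively_append_iff)

lemma slow_growth_Cons: "slow_growth (x # xs) \<longleftrightarrow> slow_growth xs \<and> (xs = [] \<or> hd xs \<le> x + 1)"
  by (auto simp: slow_growth_def successively_Cons)

lemma slow_growth_replicate: "slow_growth (replicate k c)"
  by (auto simp: slow_growth_def successively_conv_nth)

lemma slow_growth_Nil: "slow_growth []"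
  by (simp add: slow_growth_def)

text \<open>The tight joins are in the output words: \<open>hd A \<le> 2\<close> after the 1,
  \<open>last A \<ge> 0\<close> before the final 1s, \<open>hd B \<le> 1\<close> after the 0s and
  \<open>last B \<ge> - 1\<close> before the 0.\<close>

lemma NU2_template_QDV: "NU2_template u w \<Longrightarrow> u \<in> QDV \<and> w \<in> QDV"
proof (induction rule: NU2_template.induct)
  case (rule_a h A)
  obtain g where g: "h = Suc (Suc g)" using rule_a by (metis Suc_le_D numeral_2_eq_2 Suc_le_mono)
  show ?case
  proof (cases "A = []")
    case True
    then show ?thesis
      by (simp add: g QDV_def slow_growth_append slow_growth_Cons slow_growth_replicate
          slow_growth_Nil hd_append last_append last_replicate)
  next
    case False
    moreover from this have "hd A \<le> 2" "last A \<ge> 0" "slow_growth A" using rule_a by auto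
    ultimately show ?thesis
      by (simp add: g QDV_def slow_growth_append slow_growth_Cons slow_growth_replicate
          slow_growth_Nil hd_append last_append last_replicate)
  qed
next
  case (rule_b k B)
  obtain g where g: "k = Suc g" using rule_b by (cases k) auto
  show ?case using rule_b
    by (cases "B = []")
      (simp_all add: g QDV_def slow_growth_append slow_growth_Cons slow_growth_replicate
          slow_growth_Nil hd_append last_append last_replicate)
qed

section \<open>Recovering the rule from a word\<close>

definition lead :: "'a \<Rightarrow> 'a list \<Rightarrow> nat" where
  "lead c xs = length (takeWhile ((=) c) xs)"

lemma lead_replicate_append: "lead c (replicate k c @ xs) = k + lead c xs"
  by (induction k) (auto simp: lead_def)

lemma lead_Cons: "lead c (x # xs) = (if c = x then Suc (lead c xs) else 0)"
  by (simp add: lead_def)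

lemma lead_eq_0: "xs \<noteq> [] \<Longrightarrow> hd xs \<noteq> c \<Longrightarrow> lead c xs = 0"
  by (cases xs) (auto simp: lead_def)

text \<open>Which rule applies to \<open>u\<close>, and the parameter \<open>h\<close> or \<open>k\<close>, are determined by the lengths
  of the initial run of 2s (after 01) and of the final run of \<open>-1\<close>s.\<close>

lemma NU2_template_input:
  assumes "NU2_template u w"
  shows "let a = lead 2 (drop 2 u); t = lead (- 1) (rev u) in
    t < a \<and> (\<exists>A. u = [0, 1] @ replicate (Suc t) 2 @ A @ replicate t (- 1) \<and>
                  w = [0] @ replicate t 0 @ [1] @ A @ replicate (Suc t) 1) \<or>
    a \<le> t \<and> (\<exists>B. u = [0, 1] @ replicate a 2 @ B @ replicate a (- 1) \<and>
                  w = [0] @ replicate a 0 @ B @ [0] @ replicate a 1)"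
  using assms
proof (induction rule: NU2_template.induct)
  case (rule_a h A)
  let ?u = "[0, 1] @ replicate h 2 @ A @ replicate (h - 1) (- 1) :: int list"
  obtain g where g: "h = Suc g" using rule_a by (cases h) auto
  have "lead 2 (drop 2 ?u) = h + lead 2 (A @ replicate (h - 1) (- 1))"
    by (simp add: lead_replicate_append)
  moreover have "lead (- 1) (rev ?u) = g + lead (- 1) (rev A @ replicate h 2 @ [1, 0])"
    by (simp add: g lead_replicate_append flip: replicate_append_same)
  \<comment> \<open>The letter before the final -1s is \<open>last A\<close>, which is nonnegative,
    or else a 2. So that run has length exactly \<open>h - 1\<close>, shorter than the run of
    2s.\<close>
  moreover have "lead (- 1) (rev A @ replicate h 2 @ [1, 0 :: int]) = 0"
    by (rule lead_eq_0) (use rule_a in \<open>auto simp: g hd_append hd_rev\<close>)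
  ultimately show ?case
    unfolding Let_def by (intro disjI1 conjI exI[of _ A]) (simp_all add: g)
next
  case (rule_b k B)
  let ?u = "[0, 1] @ replicate k 2 @ B @ replicate k (- 1) :: int list"
  have "lead 2 (drop 2 ?u) = k + lead 2 (B @ replicate k (- 1))"
    by (simp add: lead_replicate_append)
  \<comment> \<open>The letter after the 2s is \<open>hd B\<close>, which is at most 1, or else -1.
    So the run of 2s has length exactly \<open>k\<close>.\<close>
  moreover have "lead 2 (B @ replicate k (- 1 :: int)) = 0"
    by (rule lead_eq_0) (use rule_b in \<open>auto simp: hd_append hd_replicate\<close>)
  moreover have "lead (- 1) (rev ?u) \<ge> k"
    by (simp add: lead_replicate_append)
  ultimately show ?case
    unfolding Let_def by (intro disjI2 conjI exI[of _ B]) simp_all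
qed

text \<open>The initial 0s and final 1s of \<open>w\<close> play the same role here. Under rule (a)
  a 1 stops the 0s at exactly \<open>h\<close>, with at least \<open>h\<close> final 1s; under rule
  (b) a 0 stops the 1s at exactly \<open>k\<close>, with more than \<open>k\<close> initial
  0s.\<close>

lemma NU2_template_output:
  assumes "NU2_template u w"
  shows "let z = lead 0 w; e = lead 1 (rev w) in
    z \<le> e \<and> (\<exists>A. u = [0, 1] @ replicate z 2 @ A @ replicate (z - 1) (- 1) \<and>
                  w = replicate z 0 @ [1] @ A @ replicate z 1) \<or>
    e < z \<and> (\<exists>B. u = [0, 1] @ replicate e 2 @ B @ replicate e (- 1) \<and>
                  w = replicate (Suc e) 0 @ B @ [0] @ replicate e 1)"
  using assms
proof (induction rule: NU2_template.induct)
  case (rule_a h A)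
  obtain g where g: "h = Suc g" using rule_a by (cases h) auto
  let ?w = "[0] @ replicate (h - 1) 0 @ [1] @ A @ replicate h 1 :: int list"
  have w: "?w = replicate h 0 @ [1] @ A @ replicate h 1" by (simp add: g)
  have "lead 0 ?w = h"
    unfolding w lead_replicate_append by (simp add: lead_Cons)
  moreover have "lead 1 (rev ?w) \<ge> h"
    unfolding w by (simp add: lead_replicate_append)
  ultimately show ?case
    unfolding Let_def by (intro disjI1 conjI exI[of _ A]) (simp_all add: g)
next
  case (rule_b k B)
  let ?w = "[0] @ replicate k 0 @ B @ [0] @ replicate k 1 :: int list"
  have w: "?w = replicate (Suc k) 0 @ B @ [0] @ replicate k 1" by simp
  have "lead 0 ?w \<ge> Suc k"
    unfolding w lead_replicate_append by simp
  moreover have "lead 1 (rev ?w) = k"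
    unfolding w by (simp add: lead_replicate_append lead_Cons)
  ultimately show ?case
    unfolding Let_def by (intro disjI2 conjI exI[of _ B]) simp_all
qed

text \<open>Both derivations see the same two runs, hence the same rule and parameter; cancelling
  the common blocks identifies the middle lists.\<close>

lemma NU2_template_functional:
  assumes "NU2_template u w" "NU2_template u w'"
  shows "w = w'"
proof -
  define a t where "a = lead 2 (drop 2 u)" and "t = lead (- 1) (rev u)"
  show ?thesis
    using NU2_template_input[OF assms(1)] NU2_template_input[OF assms(2)]
    unfolding Let_def a_def[symmetric] t_def[symmetric] by auto
qed

lemma NU2_template_injective:
  assumes "NU2_template u w" "NU2_template u' w"
  shows "u = u'"
proof -
  define z e where "z = lead 0 w" and "e = lead 1 (rev w)"
  show ?thesis
    using NU2_template_output[OF assms(1)] NU2_template_output[OF assms(2)]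
    unfolding Let_def z_def[symmetric] e_def[symmetric] by auto
qed

section \<open>Template words inside their classes\<close>

lemma NU2_template_nth:
  assumes "NU2_template u w"
  shows "4 \<le> length u" "u ! 2 = 2" "u ! 3 \<le> 2" "last u = - 1"
    "3 \<le> length w" "w ! 1 = 0" "last w = 1"
  using assms
proof (atomize (full), induction rule: NU2_template.induct)
  case (rule_a h A)
  obtain g where g: "h = Suc (Suc g)" using rule_a by (metis Suc_le_D numeral_2_eq_2 Suc_le_mono)
  show ?case by (simp add: g numeral_2_eq_2 numeral_3_eq_3)
next
  case (rule_b k B)
  obtain g where g: "k = Suc g" using rule_b by (cases k) auto
  show ?case using rule_b
    \<comment> \<open>For \<open>k = 1\<close> the fourth letter is \<open>hd B\<close>, or -1 if
      \<open>B\<close> is empty; otherwise it is 2.\<close>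
    by (cases B; cases g) (simp_all add: g numeral_2_eq_2 numeral_3_eq_3)
qed

lemma last_qdv_of: "0 < n \<Longrightarrow> last (qdv_of n \<gamma>) = int n - 1 - int (part \<gamma> 1)"
  by (cases n) (simp_all add: qdv_of_def)

text \<open>An entry 2 at index 2 means a zero part, an entry below 3 at index 3 a positive one;
  this puts the length at \<open>length \<gamma> + 3\<close>. The last entry -1 then gives the
  largest part.\<close>

lemma NU2_template_input_class:
  assumes "NU2_template u w" "\<gamma> \<in> partitions" "u \<in> class_of \<gamma>"
  shows "u = qdv_of (length \<gamma> + 3) \<gamma>" "part \<gamma> 1 = length \<gamma> + 3"
proof -
  obtain n where n: "length \<gamma> < n" "u = qdv_of n \<gamma>" using assms by (auto simp: class_of_def)
  note * = NU2_template_nth(1-4)[OF assms(1), unfolded n(2)]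
  have "part \<gamma> (n - 2) = 0" "0 < part \<gamma> (n - 3)" using *(1-3) by simp_all
  then have "n = length \<gamma> + 3" using part_pos_iff[OF assms(2)] *(1)
    by (auto simp: part_eq_0_iff[OF assms(2)])
  then show "u = qdv_of (length \<gamma> + 3) \<gamma>" "part \<gamma> 1 = length \<gamma> + 3"
    using n *(4) by (simp_all add: last_qdv_of)
qed

text \<open>The entry 0 at index 1 comes from a positive part, so the word is the shortest of its
  class. Its last entry 1 makes the largest part \<open>length \<delta> - 1\<close>.\<close>

lemma NU2_template_output_class:
  assumes "NU2_template u w" "\<delta> \<in> partitions" "w \<in> class_of \<delta>"
  shows "w = qdv_of (length \<delta> + 1) \<delta>" "part \<delta> 1 < length \<delta>"
proof -
  obtain n where n: "length \<delta> < n" "w = qdv_of n \<delta>" using assms by (auto simp: class_of_def)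
  note * = NU2_template_nth(5-7)[OF assms(1), unfolded n(2)]
  have "0 < part \<delta> (n - 1)" using *(1,2) by simp
  then have "n = length \<delta> + 1" using part_pos_iff[OF assms(2)] n(1) by auto
  then show "w = qdv_of (length \<delta> + 1) \<delta>" "part \<delta> 1 < length \<delta>"
    using n *(1,3) by (simp_all add: last_qdv_of)
qed

text \<open>Only one word of a class has the right length to be an input, and only one to be an
  output. The choice of representatives thus disappears, and properties of the word rules pass to
  classes.\<close>

lemma NU2_graph_iff:
  "NU2_graph \<gamma> \<delta> \<longleftrightarrow> \<gamma> \<in> partitions \<and> \<delta> \<in> partitions \<and>
     NU2_template (qdv_of (length \<gamma> + 3) \<gamma>) (qdv_of (length \<delta> + 1) \<delta>)"
proof
  assume "NU2_graph \<gamma> \<delta>"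
  then obtain u w where *: "\<gamma> \<in> partitions" "\<delta> \<in> partitions" "NU2_template u w"
    "class_of \<gamma> = dyck_class u" "class_of \<delta> = dyck_class w"
    by (auto simp: NU2_graph_def)
  then have "u \<in> class_of \<gamma>" "w \<in> class_of \<delta>"
    using class_of_eq_dyck_class_iff NU2_template_QDV by blast+
  then show "\<gamma> \<in> partitions \<and> \<delta> \<in> partitions \<and>
     NU2_template (qdv_of (length \<gamma> + 3) \<gamma>) (qdv_of (length \<delta> + 1) \<delta>)"
    using * NU2_template_input_class(1) NU2_template_output_class(1) by metis
next
  let ?u = "qdv_of (length \<gamma> + 3) \<gamma>" and ?w = "qdv_of (length \<delta> + 1) \<delta>"
  assume *: "\<gamma> \<in> partitions \<and> \<delta> \<in> partitions \<and> NU2_template ?u ?w"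
  have "?u \<in> class_of \<gamma>" "?w \<in> class_of \<delta>" by (auto simp: class_of_def)
  then show "NU2_graph \<gamma> \<delta>"
    unfolding NU2_graph_def using * class_of_eq_dyck_class_iff NU2_template_QDV by blast
qed

lemma qdv_of_in_class_of: "length \<gamma> < n \<Longrightarrow> qdv_of n \<gamma> \<in> class_of \<gamma>"
  by (auto simp: class_of_def)

lemma NU2_graph_functional: "NU2_graph \<gamma> \<delta> \<Longrightarrow> NU2_graph \<gamma> \<delta>' \<Longrightarrow> \<delta> = \<delta>'"
  unfolding NU2_graph_iff
  using class_of_unique[of \<delta> \<delta>' "qdv_of (length \<delta> + 1) \<delta>"]
  by (metis NU2_template_functional less_add_one qdv_of_in_class_of)

lemma NU2_graph_injective: "NU2_graph \<gamma> \<delta> \<Longrightarrow> NU2_graph \<gamma>' \<delta> \<Longrightarrow> \<gamma> = \<gamma>'"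
  unfolding NU2_graph_iff
  using class_of_unique[of \<gamma> \<gamma>' "qdv_of (length \<gamma> + 3) \<gamma>"]
  by (metis NU2_template_injective less_add_same_cancel1 zero_less_numeral qdv_of_in_class_of)

lemma NU2_graph_not_D1: "NU2_graph \<gamma> \<delta> \<Longrightarrow> \<gamma> \<notin> D1"
  using NU2_template_input_class(2)[of _ _ \<gamma>] qdv_of_in_class_of[of \<gamma> "length \<gamma> + 3"]
  by (fastforce simp: NU2_graph_iff D1_def)

lemma NU2_graph_not_C1: "NU2_graph \<gamma> \<delta> \<Longrightarrow> \<delta> \<notin> C1"
  using NU2_template_output_class(2)[of _ _ \<delta>] qdv_of_in_class_of[of \<delta> "length \<delta> + 1"]
  by (fastforce simp: NU2_graph_iff C1_def)

lemma NU2_template_obtain_classes: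
  assumes "NU2_template u w"
  obtains \<gamma> \<delta> where "\<gamma> \<in> partitions" "class_of \<gamma> = dyck_class u"
    "\<delta> \<in> partitions" "class_of \<delta> = dyck_class w"
proof -
  have q: "u \<in> QDV" "w \<in> QDV" using NU2_template_QDV[OF assms] by auto
  obtain \<gamma> where "\<gamma> \<in> partitions" "u \<in> class_of \<gamma>" using ex_class_of[OF q(1)] .
  moreover obtain \<delta> where "\<delta> \<in> partitions" "w \<in> class_of \<delta>" using ex_class_of[OF q(2)] .
  ultimately show ?thesis
    using q by (intro that[of \<gamma> \<delta>]) (simp_all add: class_of_eq_dyck_class_iff)
qed

lemma D2_iff: "\<gamma> \<in> D2 \<longleftrightarrow> (\<exists>\<delta>. NU2_graph \<gamma> \<delta>)"
proof
  assume "\<gamma> \<in> D2"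
  then obtain u w where *: "\<gamma> \<in> partitions" "NU2_template u w" "class_of \<gamma> = dyck_class u"
    by (auto simp: D2_def)
  moreover obtain \<delta> where "\<delta> \<in> partitions" "class_of \<delta> = dyck_class w"
    using NU2_template_obtain_classes[OF *(2)] .
  ultimately show "\<exists>\<delta>. NU2_graph \<gamma> \<delta>" unfolding NU2_graph_def by blast
qed (auto simp: D2_def NU2_graph_def)

lemma C2_iff: "\<delta> \<in> C2 \<longleftrightarrow> (\<exists>\<gamma>. NU2_graph \<gamma> \<delta>)"
proof
  assume "\<delta> \<in> C2"
  then obtain u w where *: "\<delta> \<in> partitions" "NU2_template u w" "class_of \<delta> = dyck_class w"
    by (auto simp: C2_def)
  moreover obtain \<gamma> where "\<gamma> \<in> partitions" "class_of \<gamma> = dyck_class u"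
    using NU2_template_obtain_classes[OF *(2)] .
  ultimately show "\<exists>\<gamma>. NU2_graph \<gamma> \<delta>" unfolding NU2_graph_def by blast
qed (auto simp: C2_def NU2_graph_def)

lemma NU2_graph_stats:
  assumes "NU2_graph \<gamma> \<delta>"
  shows "dinv_part \<delta> = dinv_part \<gamma> + 1" "defc_part \<delta> = defc_part \<gamma>"
proof -
  let ?u = "qdv_of (length \<gamma> + 3) \<gamma>" and ?w = "qdv_of (length \<delta> + 1) \<delta>"
  have "NU2_template ?u ?w" "?u \<in> class_of \<gamma>" "?w \<in> class_of \<delta>"
    using assms by (auto simp: NU2_graph_iff qdv_of_in_class_of)
  then show "dinv_part \<delta> = dinv_part \<gamma> + 1" "defc_part \<delta> = defc_part \<gamma>"
    using stats_part[of ?u \<gamma>] stats_part[of ?w \<delta>] NU2_template_dinv NU2_template_coarea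
    by auto
qed

section \<open>The first map\<close>

text \<open>The bound defining \<open>D1\<close> says that the new first part
  \<open>length \<gamma> + 1\<close> is at least \<open>part \<gamma> 1 - 1\<close>.\<close>

lemma NU1_raw_sorted:
  assumes "\<gamma> \<in> D1"
  shows "sorted_wrt (\<ge>) ((length \<gamma> + 1) # map (\<lambda>x. x - 1) \<gamma>)"
proof -
  have "x \<le> part \<gamma> 1" if "x \<in> set \<gamma>" for x
    using that assms by (cases \<gamma>) (auto simp: D1_def partitions_def part_def)
  moreover have "part \<gamma> 1 \<le> length \<gamma> + 2" using assms by (simp add: D1_def)
  ultimately have "x - 1 \<le> length \<gamma> + 1" if "x \<in> set \<gamma>" for x
    using that by fastforce
  moreover have "sorted_wrt (\<ge>) (map (\<lambda>x. x - 1) \<gamma>)"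
    using assms by (auto simp: D1_def partitions_def sorted_wrt_iff_nth_less intro!: diff_le_mono)
  ultimately show ?thesis by auto
qed

lemma part_NU1:
  assumes "\<gamma> \<in> D1"
  shows "part (NU1 \<gamma>) (Suc i) = (if i = 0 then length \<gamma> + 1 else part \<gamma> i - 1)"
  unfolding NU1_def part_filter_pos[OF NU1_raw_sorted[OF assms]]
  by (cases i) (auto simp: part_def)

lemma length_NU1_le: "length (NU1 \<gamma>) \<le> length \<gamma> + 1"
  using length_filter_le[of "\<lambda>x. x > 0" "(length \<gamma> + 1) # map (\<lambda>x. x - 1) \<gamma>"]
  by (simp only: NU1_def list.size length_map)

lemma NU1_in_C1:
  assumes "\<gamma> \<in> D1"
  shows "NU1 \<gamma> \<in> C1"
proof -
  have "NU1 \<gamma> \<in> partitions"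
    unfolding NU1_def by (rule filter_pos_in_partitions[OF NU1_raw_sorted[OF assms]])
  moreover have "length (NU1 \<gamma>) \<le> length \<gamma> + 1"
    by (rule length_NU1_le)
  moreover have "NU1 \<gamma> \<noteq> []" by (simp add: NU1_def)
  ultimately show ?thesis using part_NU1[OF assms, of 0] by (simp add: C1_def)
qed

text \<open>Isolates the parts 1, which \<open>NU1\<close> turns into zeros and drops, and which
  \<open>ND1\<close> has to restore in the right number.\<close>

lemma partition_split_ones:
  assumes "\<gamma> \<in> partitions"
  shows "\<gamma> = filter (\<lambda>x. x > 1) \<gamma> @ replicate (length \<gamma> - length (filter (\<lambda>x. x > 1) \<gamma>)) 1"
  using assms
proof (induction \<gamma>)
  case (Cons x \<gamma>)
  then have IH: "\<gamma> = filter (\<lambda>x. x > 1) \<gamma> @ replicate (length \<gamma> - length (filter (\<lambda>x. x > 1) \<gamma>)) 1"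
    by (auto simp: partitions_def)
  show ?case
  proof (cases "x > 1")
    case True
    then show ?thesis using IH by simp
  next
    case False
    then have "x = 1" "\<forall>y\<in>set \<gamma>. y = 1"
      using Cons.prems by (auto simp: partitions_def) (metis Suc_leI gr0I le_antisym not_less)+
    then have "filter (\<lambda>x. x > 1) \<gamma> = []" "\<gamma> = replicate (length \<gamma>) 1"
      by (auto simp: filter_empty_conv replicate_length_same)
    then show ?thesis using \<open>x = 1\<close> by simp
  qed
qed simp

lemma ND1_NU1:
  assumes "\<gamma> \<in> D1"
  shows "ND1 (NU1 \<gamma>) = \<gamma>"
proof -
  have p: "\<gamma> \<in> partitions" using assms by (simp add: D1_def)
  have tl: "NU1 \<gamma> = (length \<gamma> + 1) # map (\<lambda>x. x - 1) (filter (\<lambda>x. x > 1) \<gamma>)"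
    by (simp add: NU1_def filter_map comp_def)
  have "map (\<lambda>x. x + 1) (map (\<lambda>x. x - 1) (filter (\<lambda>x. x > 1) \<gamma>)) = filter (\<lambda>x. x > 1) \<gamma>"
    unfolding map_map by (rule map_idI) auto
  then show ?thesis
    using partition_split_ones[OF p] by (simp add: ND1_def tl part_def)
qed

text \<open>The tail has \<open>length \<gamma> - 1\<close> parts and
  \<open>part \<gamma> 1 - length \<gamma>\<close> ones are added; membership in \<open>C1\<close>
  makes this subtraction exact.\<close>

lemma length_ND1: "\<gamma> \<in> C1 \<Longrightarrow> Suc (length (ND1 \<gamma>)) = part \<gamma> 1"
  by (cases \<gamma>) (auto simp: C1_def ND1_def)

lemma ND1_in_D1:
  assumes "\<gamma> \<in> C1"
  shows "ND1 \<gamma> \<in> D1"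
proof -
  have l: "Suc (length (ND1 \<gamma>)) = part \<gamma> 1" by (rule length_ND1[OF assms])
  obtain x xs where \<gamma>: "\<gamma> = x # xs" using assms by (cases \<gamma>) (auto simp: C1_def)
  have "sorted_wrt (\<ge>) (map (\<lambda>x. x + 1) xs)"
    using assms by (simp add: \<gamma> C1_def partitions_def sorted_wrt_map)
  then have "ND1 \<gamma> \<in> partitions"
    using assms by (auto simp: \<gamma> ND1_def C1_def partitions_def sorted_wrt_append sorted_wrt_iff_nth_less[of _ "replicate _ _"])
  \<comment> \<open>The first part of the image is the second part of \<gamma> plus one, or 1 or 0
    if \<gamma> has a single part.\<close>
  moreover have "part (ND1 \<gamma>) 1 \<le> part \<gamma> 1 + 1"
    using assms by (cases xs) (auto simp: \<gamma> ND1_def C1_def partitions_def part_def)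
  ultimately show ?thesis using l by (simp add: D1_def)
qed

lemma NU1_ND1:
  assumes "\<gamma> \<in> C1"
  shows "NU1 (ND1 \<gamma>) = \<gamma>"
proof -
  obtain x xs where \<gamma>: "\<gamma> = x # xs" using assms by (cases \<gamma>) (auto simp: C1_def)
  have "length (ND1 \<gamma>) + 1 = x" using length_ND1[OF assms] by (simp add: \<gamma> part_def)
  moreover have "filter (\<lambda>x. x > 0) (map (\<lambda>x. x - 1) (ND1 \<gamma>)) = xs"
    using assms by (auto simp: \<gamma> ND1_def C1_def partitions_def comp_def filter_empty_conv intro!: filter_True intro: gr0I)
  moreover have "x > 0" using assms by (auto simp: \<gamma> C1_def partitions_def)
  ultimately show ?thesis by (simp add: NU1_def \<gamma>)
qed

lemma NU1_stats:
  assumes "\<gamma> \<in> D1"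
  shows "dinv_part (NU1 \<gamma>) = dinv_part \<gamma> + 1" "defc_part (NU1 \<gamma>) = defc_part \<gamma>"
proof -
  \<comment> \<open>These lengths make the second vector the first one with its tail raised by one
    and a 0 appended, the form treated by \<open>dinv_cycle\<close>. The last entry is 0 since the
    new first part is \<open>length \<gamma> + 1\<close>.\<close>
  let ?v = "qdv_of (length \<gamma> + 1) \<gamma>" and ?w = "qdv_of (length \<gamma> + 2) (NU1 \<gamma>)"
  have p: "\<gamma> \<in> partitions" using assms by (simp add: D1_def)
  have l: "length (NU1 \<gamma>) < length \<gamma> + 2"
    using length_NU1_le[of \<gamma>] by simp
  obtain y where y: "?v = 0 # y"
    using qdv_of_in_QDV[OF p, of "length \<gamma> + 1"] by (cases ?v) (auto simp: QDV_def)
  then have ly: "length y = length \<gamma>" using length_qdv_of[of "length \<gamma> + 1" \<gamma>] by simp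
  have ynth: "y ! i = int i + 1 - int (part \<gamma> (length \<gamma> - i))" if "i < length \<gamma>" for i
    using that nth_qdv_of[of "Suc i" "length \<gamma> + 1" \<gamma>, unfolded y] by simp
  have "?w = 0 # plus1 y @ [0]"
  proof (rule nth_equalityI)
    fix i assume "i < length ?w"
    then have i: "i < length \<gamma> + 2" by simp
    consider "i = 0" | j where "i = Suc j" "j < length \<gamma>" | "i = length \<gamma> + 1"
      using i by (cases i) (auto simp: less_Suc_eq)
    then show "?w ! i = (0 # plus1 y @ [0]) ! i"
    proof cases
      case 1
      then show ?thesis using part_NU1[OF assms, of "length \<gamma> + 1"] by (simp add: part_def)
    next
      case 2
      \<comment> \<open>Positivity makes the subtraction of 1 from this part exact, so the entry
        rises by one.\<close>
      then have "0 < part \<gamma> (length \<gamma> - j)" using part_pos_iff[OF p] by simp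
      moreover have "length \<gamma> + 2 - i = Suc (length \<gamma> - j)" using 2 by simp
      ultimately show ?thesis
        using 2 part_NU1[OF assms, of "length \<gamma> - j"] i
        by (simp add: ly nth_append plus1_def ynth)
    next
      case 3
      then show ?thesis using part_NU1[OF assms, of 0] by (simp add: ly nth_append)
    qed
  qed (simp add: ly)
  then have "dinv ?w = dinv ?v + 1" "coarea ?w = coarea ?v + 1"
    by (simp_all only: y dinv_cycle coarea_cycle)
  then show "dinv_part (NU1 \<gamma>) = dinv_part \<gamma> + 1" "defc_part (NU1 \<gamma>) = defc_part \<gamma>"
    using stats_part[of ?v \<gamma>] stats_part[of ?w "NU1 \<gamma>"] l by (auto simp: qdv_of_in_class_of)
qed

section \<open>The combined maps\<close>

text \<open>\<open>NU1\<close> and \<open>ND1\<close> are mutually inverse and the second map is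
  reversed by definition. Single-valuedness of \<open>ND\<close> thus amounts to injectivity of
  \<open>NU\<close>.\<close>

lemma ND_graph_iff: "ND_graph \<delta> \<gamma> \<longleftrightarrow> NU_graph \<gamma> \<delta>"
  unfolding ND_graph_def NU_graph_def
  using ND1_NU1 NU1_ND1 NU1_in_C1 ND1_in_D1 by metis

text \<open>The two domains are disjoint, so the prescriptions cannot conflict.\<close>

lemma NU_graph_functional: "NU_graph \<gamma> \<delta> \<Longrightarrow> NU_graph \<gamma> \<delta>' \<Longrightarrow> \<delta> = \<delta>'"
  unfolding NU_graph_def using NU2_graph_functional NU2_graph_not_D1 by blast

lemma NU_graph_injective: "NU_graph \<gamma> \<delta> \<Longrightarrow> NU_graph \<gamma>' \<delta> \<Longrightarrow> \<gamma> = \<gamma>'"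
  unfolding ND_graph_iff[symmetric] ND_graph_def
  using NU2_graph_injective NU2_graph_not_C1 by blast

lemma D_iff: "\<gamma> \<in> D \<longleftrightarrow> (\<exists>\<delta>. NU_graph \<gamma> \<delta>)"
  by (auto simp: D_def D2_iff NU_graph_def)

lemma C_iff: "\<delta> \<in> C \<longleftrightarrow> (\<exists>\<gamma>. NU_graph \<gamma> \<delta>)"
  unfolding ND_graph_iff[symmetric] by (auto simp: C_def C2_iff ND_graph_def)

lemma NU_graph_stats:
  "NU_graph \<gamma> \<delta> \<Longrightarrow> dinv_part \<delta> = dinv_part \<gamma> + 1 \<and> defc_part \<delta> = defc_part \<gamma>"
  unfolding NU_graph_def using NU1_stats NU2_graph_stats by blast

lemma NU_eqI: "NU_graph \<gamma> \<delta> \<Longrightarrow> NU \<gamma> = \<delta>"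
  unfolding NU_def using NU_graph_functional by blast

lemma ND_eqI: "NU_graph \<gamma> \<delta> \<Longrightarrow> ND \<delta> = \<gamma>"
  unfolding ND_def ND_graph_iff using NU_graph_injective by blast

lemma NU_graph_NU: "\<gamma> \<in> D \<Longrightarrow> NU_graph \<gamma> (NU \<gamma>)"
  using D_iff NU_eqI by metis

lemma NU_graph_ND: "\<delta> \<in> C \<Longrightarrow> NU_graph (ND \<delta>) \<delta>"
  using C_iff ND_eqI by metis

lemma dinv_part_funpow_NU:
  "(\<And>m. m < j \<Longrightarrow> (NU ^^ m) \<gamma> \<in> D) \<Longrightarrow> dinv_part ((NU ^^ j) \<gamma>) = dinv_part \<gamma> + int j"
  by (induction j) (simp_all add: NU_graph_stats[OF NU_graph_NU])

theorem theorem3p6: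
  shows
    "((\<forall>\<gamma> \<in> D. \<exists>!\<delta>. NU_graph \<gamma> \<delta>) \<and>
      (\<forall>\<gamma> \<in> C. \<exists>!\<delta>. ND_graph \<gamma> \<delta>) \<and>
      bij_betw NU D C \<and>
      bij_betw ND C D \<and>
      (\<forall>\<gamma> \<in> D. ND (NU \<gamma>) = \<gamma>) \<and>
      (\<forall>\<gamma> \<in> C. NU (ND \<gamma>) = \<gamma>)) \<and>
     (\<forall>\<gamma> \<in> D. defc_part (NU \<gamma>) = defc_part \<gamma> \<and> dinv_part (NU \<gamma>) = dinv_part \<gamma> + 1) \<and>
     (\<forall>\<gamma> \<in> C. defc_part (ND \<gamma>) = defc_part \<gamma> \<and> dinv_part (ND \<gamma>) = dinv_part \<gamma> - 1) \<and>
     (\<forall>\<gamma> \<in> D. \<forall>i j. i < j \<longrightarrow> (\<forall>m < j. (NU ^^ m) \<gamma> \<in> D) \<longrightarrow>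
        (NU ^^ i) \<gamma> \<noteq> (NU ^^ j) \<gamma>)"
proof -
  have inC: "NU \<gamma> \<in> C" and ND_NU: "ND (NU \<gamma>) = \<gamma>" if "\<gamma> \<in> D" for \<gamma>
    using NU_graph_NU[OF that] C_iff ND_eqI by auto
  have inD: "ND \<gamma> \<in> D" and NU_ND: "NU (ND \<gamma>) = \<gamma>" if "\<gamma> \<in> C" for \<gamma>
    using NU_graph_ND[OF that] D_iff NU_eqI by auto
  have "bij_betw NU D C"
    by (rule bij_betw_byWitness[where f' = ND]) (use inC inD ND_NU NU_ND in auto)
  moreover have "bij_betw ND C D"
    by (rule bij_betw_byWitness[where f' = NU]) (use inC inD ND_NU NU_ND in auto)
  moreover have "\<exists>!\<delta>. NU_graph \<gamma> \<delta>" if "\<gamma> \<in> D" for \<gamma>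
    using that D_iff NU_graph_functional by blast
  moreover have "\<exists>!\<delta>. ND_graph \<gamma> \<delta>" if "\<gamma> \<in> C" for \<gamma>
    unfolding ND_graph_iff using that C_iff NU_graph_injective by blast
  moreover have "defc_part (NU \<gamma>) = defc_part \<gamma> \<and> dinv_part (NU \<gamma>) = dinv_part \<gamma> + 1"
    if "\<gamma> \<in> D" for \<gamma>
    using NU_graph_stats[OF NU_graph_NU[OF that]] by simp
  moreover have "defc_part (ND \<gamma>) = defc_part \<gamma> \<and> dinv_part (ND \<gamma>) = dinv_part \<gamma> - 1"
    if "\<gamma> \<in> C" for \<gamma>
    using NU_graph_stats[OF NU_graph_ND[OF that]] by simp
  moreover have "(NU ^^ i) \<gamma> \<noteq> (NU ^^ j) \<gamma>"
    if "i < j" "\<forall>m < j. (NU ^^ m) \<gamma> \<in> D" for \<gamma> i j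
  proof -
    \<comment> \<open>The two values of \<open>dinv\<close> differ by \<open>j - i\<close>.\<close>
    have "dinv_part ((NU ^^ i) \<gamma>) \<noteq> dinv_part ((NU ^^ j) \<gamma>)"
      using that by (simp add: dinv_part_funpow_NU)
    then show ?thesis by metis
  qed
  ultimately show ?thesis using ND_NU NU_ND by blast
qed

end
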